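(* Let $G$ be a graph with $n$ vertices and maximum degree $3$, let $S$ be any $n \times n$ grid point set, and let $\mu$ be any bijection from the vertex set of $G$ to $S$. Then $G$ admits a $\mu$-respecting restricted RAC$_2$ embedding on $S$.
   Context: An $n \times n$ grid point set is a set $S$ of $n$ points with integer coordinates in $\{1,\dots,n\}^2$ such that no two points of $S$ lie on a common horizontal or a common vertical line. A point-set embedding of $G=(V,E)$ on $S$ consists of a bijection $V \to S$ and a polyline drawing of $G$ with each vertex at its assigned point and each edge a polygonal chain between its endpoints' points; edges may not overlap (share a segment of positive length) and may not pass through points representing other vertices. It is $\mu$-respecting if the bijection used is $\mu$. A restricted RAC$_2$ embedding is such an embedding in which every bend lies on a point with integer coordinates, every edge segment is horizontal or vertical, every edge has at most two bends, and any two crossing edges cross at a right angle. The drawing is not required to stay within any bounded region (bends may lie outside $\{1,\dots,n\}^2$). *)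

theory Defs
  imports "HOL-Analysis.Analysis"
begin

definition simple_graph :: "'a set \<Rightarrow> 'a set set \<Rightarrow> bool" where
  "simple_graph V E \<longleftrightarrow> finite V \<and> (\<forall>e\<in>E. e \<subseteq> V \<and> card e = 2)"

definition graph_degree :: "'a set set \<Rightarrow> 'a \<Rightarrow> nat" where
  "graph_degree E v = card {e \<in> E. v \<in> e}"

type_synonym point = "real \<times> real"

definition grid_point_set :: "nat \<Rightarrow> point set \<Rightarrow> bool" where
  "grid_point_set n S \<longleftrightarrow>
     card S = n \<and> S \<subseteq> real ` {1..n} \<times> real ` {1..n} \<and>
     (\<forall>p\<in>S. \<forall>q\<in>S. p \<noteq> q \<longrightarrow> fst p \<noteq> fst q \<and> snd p \<noteq> snd q)"

text \<open>A polygonal chain is given by the list of its corners: the two end points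
  and, in between, the bends. As usual for drawings of edges, chains have no segments of
  length zero and do not intersect themselves.\<close>

type_synonym chain = "point list"

definition num_segments :: "chain \<Rightarrow> nat" where
  "num_segments c = length c - 1"

definition segment :: "chain \<Rightarrow> nat \<Rightarrow> point set" where
  "segment c i = closed_segment (c ! i) (c ! Suc i)"

definition bends :: "chain \<Rightarrow> point list" where
  "bends c = butlast (tl c)"

definition curve :: "chain \<Rightarrow> point set" where
  "curve c = (\<Union>i<num_segments c. segment c i)"

definition polygonal_chain :: "chain \<Rightarrow> bool" where
  "polygonal_chain c \<longleftrightarrow>
     2 \<le> length c \<and>
     (\<forall>i<num_segments c. c ! i \<noteq> c ! Suc i) \<and>
     (\<forall>i j. i < j \<and> j < num_segments c \<longrightarrow>
        segment c i \<inter> segment c j = (if j = Suc i then {c ! j} else {}))"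

definition overlap :: "chain \<Rightarrow> chain \<Rightarrow> bool" where
  "overlap c d \<longleftrightarrow> (\<exists>a b. a \<noteq> b \<and> closed_segment a b \<subseteq> curve c \<inter> curve d)"

text \<open>An embedding on \<open>S\<close> is a bijection \<open>\<phi>\<close> from the vertices to \<open>S\<close> together with a
  drawing \<open>D\<close> that assigns a chain to every edge; it is \<open>\<mu>\<close>-respecting iff \<open>\<phi>\<close> is \<open>\<mu>\<close>.\<close>

definition point_set_embedding ::
  "'a set \<Rightarrow> 'a set set \<Rightarrow> point set \<Rightarrow> ('a \<Rightarrow> point) \<Rightarrow> ('a set \<Rightarrow> chain) \<Rightarrow> bool" where
  "point_set_embedding V E S \<phi> D \<longleftrightarrow>
     bij_betw \<phi> V S \<and>
     (\<forall>e\<in>E. polygonal_chain (D e) \<and> {hd (D e), last (D e)} = \<phi> ` e) \<and>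
     (\<forall>e\<in>E. \<forall>f\<in>E. e \<noteq> f \<longrightarrow> \<not> overlap (D e) (D f)) \<and>
     (\<forall>e\<in>E. \<forall>v\<in>V. v \<notin> e \<longrightarrow> \<phi> v \<notin> curve (D e))"

text \<open>Every common point of two edges other than a common end vertex counts as a crossing;
  in particular, an edge touching another one at a bend is not a right-angle crossing.\<close>

definition crossing ::
  "('a \<Rightarrow> point) \<Rightarrow> ('a set \<Rightarrow> chain) \<Rightarrow> 'a set \<Rightarrow> 'a set \<Rightarrow> point \<Rightarrow> bool" where
  "crossing \<phi> D e f p \<longleftrightarrow> p \<in> curve (D e) \<inter> curve (D f) \<and> p \<notin> \<phi> ` (e \<inter> f)"

definition right_angle_at :: "chain \<Rightarrow> chain \<Rightarrow> point \<Rightarrow> bool" where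
  "right_angle_at c d p \<longleftrightarrow>
     (\<exists>i<num_segments c. \<exists>j<num_segments d.
        p \<in> open_segment (c ! i) (c ! Suc i) \<and>
        p \<in> open_segment (d ! j) (d ! Suc j) \<and>
        orthogonal (c ! Suc i - c ! i) (d ! Suc j - d ! j))"

definition horizontal :: "point \<Rightarrow> point \<Rightarrow> bool" where
  "horizontal p q \<longleftrightarrow> snd p = snd q"

definition vertical :: "point \<Rightarrow> point \<Rightarrow> bool" where
  "vertical p q \<longleftrightarrow> fst p = fst q"

definition restricted_RAC_embedding ::
  "nat \<Rightarrow> 'a set \<Rightarrow> 'a set set \<Rightarrow> point set \<Rightarrow> ('a \<Rightarrow> point) \<Rightarrow> ('a set \<Rightarrow> chain) \<Rightarrow> bool" where
  "restricted_RAC_embedding k V E S \<phi> D \<longleftrightarrow>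
     point_set_embedding V E S \<phi> D \<and>
     (\<forall>e\<in>E. \<forall>p\<in>set (bends (D e)). fst p \<in> \<int> \<and> snd p \<in> \<int>) \<and>
     (\<forall>e\<in>E. \<forall>i<num_segments (D e).
        horizontal (D e ! i) (D e ! Suc i) \<or> vertical (D e ! i) (D e ! Suc i)) \<and>
     (\<forall>e\<in>E. length (bends (D e)) \<le> k) \<and>
     (\<forall>e\<in>E. \<forall>f\<in>E. \<forall>p. e \<noteq> f \<and> crossing \<phi> D e f p \<longrightarrow> right_angle_at (D e) (D f) p)"

end

theory Submission
  imports Defs "HOL-Combinatorics.Transposition"
begin

text \<open>By Vizing's theorem the edges can be properly coloured with four colours, one for each of the
  four axis directions. An edge leaves both of its end vertices in the direction of its colour and
  turns, outside the grid, into a track of its own parallel to the other axis. Edges at a common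
  vertex leave it in different directions. As no two vertices share a row or a column, all other
  common points of two edges are perpendicular crossings.

  For maximum degree three, Vizing's theorem is proved by adding one edge at a time, with Kempe
  chains and a single fan shift.\<close>

section \<open>Edge colouring\<close>

definition proper_edge_coloring :: "'a set set \<Rightarrow> nat \<Rightarrow> ('a set \<Rightarrow> nat) \<Rightarrow> bool" where
  "proper_edge_coloring E k c \<longleftrightarrow>
     (\<forall>e\<in>E. c e < k) \<and> (\<forall>e\<in>E. \<forall>f\<in>E. e \<noteq> f \<longrightarrow> e \<inter> f \<noteq> {} \<longrightarrow> c e \<noteq> c f)"

text \<open>All natural numbers are candidates here; the palette enters as an intersection with
  \<open>{..<k}\<close> where colours are counted or picked.\<close>

definition missing :: "'a set set \<Rightarrow> ('a set \<Rightarrow> nat) \<Rightarrow> 'a \<Rightarrow> nat set" where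
  "missing E c v = {a. \<forall>e\<in>E. v \<in> e \<longrightarrow> c e \<noteq> a}"

text \<open>When edges have two ends, such a \<open>C\<close> is the vertex set of a union of
  components of the subgraph in the colours \<open>a\<close> and \<open>b\<close>. Working with
  closed sets instead of chains avoids reasoning about paths.\<close>

definition kempe_closed :: "'a set set \<Rightarrow> ('a set \<Rightarrow> nat) \<Rightarrow> nat \<Rightarrow> nat \<Rightarrow> 'a set \<Rightarrow> bool" where
  "kempe_closed E c a b C \<longleftrightarrow> (\<forall>e\<in>E. c e \<in> {a, b} \<longrightarrow> e \<inter> C \<noteq> {} \<longrightarrow> e \<subseteq> C)"

section \<open>Degrees, and components of graphs of maximum degree two\<close>

lemma graph_degree_mono:
  assumes "finite F" "E \<subseteq> F"
  shows "graph_degree E v \<le> graph_degree F v"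
  unfolding graph_degree_def using assms by (intro card_mono) auto

lemma graph_degree_remove:
  assumes "finite E" "e \<in> E" "v \<in> e"
  shows "graph_degree E v = Suc (graph_degree (E - {e}) v)"
proof -
  have "{f \<in> E. v \<in> f} = insert e {f \<in> E - {e}. v \<in> f}" using assms by auto
  then show ?thesis unfolding graph_degree_def using assms by simp
qed

lemma graph_degree_eq_0_iff:
  assumes "finite E"
  shows "graph_degree E v = 0 \<longleftrightarrow> (\<forall>e\<in>E. v \<notin> e)"
  unfolding graph_degree_def using assms by auto

text \<open>The last conjunct only serves the induction, in which the edge at \<open>x\<close> is removed.\<close>

lemma closed_set_with_two_ends:
  assumes "finite F" "\<forall>e\<in>F. card e = 2" "\<forall>v. graph_degree F v \<le> 2" "graph_degree F x \<le> 1"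
  shows "\<exists>C w. x \<in> C \<and> (\<forall>e\<in>F. e \<inter> C \<noteq> {} \<longrightarrow> e \<subseteq> C) \<and>
    (\<forall>v\<in>C. graph_degree F v \<le> 1 \<longrightarrow> v = x \<or> v = w) \<and> (graph_degree F x = 0 \<longrightarrow> C = {x})"
  using assms
proof (induction "card F" arbitrary: F x rule: less_induct)
  case less
  note fin = less.prems(1)
  show ?case
  proof (cases "graph_degree F x = 0")
    case True
    then have "\<forall>e\<in>F. x \<notin> e" using fin by (simp add: graph_degree_eq_0_iff)
    then show ?thesis by (intro exI[of _ "{x}"]) auto
  next
    case False
    then obtain e where e: "e \<in> F" "x \<in> e" using fin by (auto simp: graph_degree_eq_0_iff)
    obtain z where z: "e = {x, z}" "z \<noteq> x"
      using less.prems(2) e by (metis card_2_iff doubleton_eq_iff insertE singletonD)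
    \<comment> \<open>The path that starts at \<open>x\<close> is followed one edge: without
      \<open>e\<close>, the neighbour \<open>z\<close> is an end vertex of what remains.\<close>
    define F' where "F' = F - {e}"
    have fin': "finite F'" and sub: "F' \<subseteq> F" using fin by (auto simp: F'_def)
    have card: "card F' < card F" unfolding F'_def using fin e by (intro card_Diff1_less)
    have dz: "graph_degree F z = Suc (graph_degree F' z)"
      unfolding F'_def using fin e z by (intro graph_degree_remove) auto
    have dx: "graph_degree F x = Suc (graph_degree F' x)"
      unfolding F'_def using fin e z by (intro graph_degree_remove) auto
    have mono: "graph_degree F' v \<le> graph_degree F v" for v
      using fin sub by (rule graph_degree_mono)
    have two': "\<forall>e\<in>F'. card e = 2" using less.prems(2) sub by auto
    have deg': "\<forall>v. graph_degree F' v \<le> 2" using mono less.prems(3) le_trans by blast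
    have "graph_degree F z \<le> 2" using less.prems(3) by simp
    then have degz: "graph_degree F' z \<le> 1" using dz by simp
    obtain C w where C: "z \<in> C" "\<forall>e\<in>F'. e \<inter> C \<noteq> {} \<longrightarrow> e \<subseteq> C"
      "\<forall>v\<in>C. graph_degree F' v \<le> 1 \<longrightarrow> v = z \<or> v = w" "graph_degree F' z = 0 \<longrightarrow> C = {z}"
      using less.hyps[OF card fin' two' deg' degz] by (elim exE conjE)
    \<comment> \<open>Since \<open>e\<close> is the only edge at \<open>x\<close>, no edge of
      \<open>F'\<close> meets \<open>x\<close>, so joining \<open>x\<close> to \<open>C\<close>
      keeps the set closed.\<close>
    have "graph_degree F' x = 0" using dx less.prems(4) by simp
    then have iso: "\<forall>e\<in>F'. x \<notin> e" using fin' by (simp add: graph_degree_eq_0_iff)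
    have closed: "\<forall>f\<in>F. f \<inter> insert x C \<noteq> {} \<longrightarrow> f \<subseteq> insert x C"
    proof (intro ballI impI)
      fix f assume f: "f \<in> F" "f \<inter> insert x C \<noteq> {}"
      show "f \<subseteq> insert x C"
      proof (cases "f = e")
        case True then show ?thesis using z C by auto
      next
        case False
        then have "f \<in> F'" using f by (simp add: F'_def)
        moreover from this have "f \<inter> C \<noteq> {}" using f(2) iso by auto
        ultimately have "f \<subseteq> C" using C(2) by simp
        then show ?thesis by auto
      qed
    qed
    \<comment> \<open>If \<open>z\<close> has no further edge, then \<open>C = {z}\<close> and
      \<open>z\<close> is the second end. Otherwise \<open>z\<close> has degree two in
      \<open>F\<close>, is no end any more, and leaves \<open>w\<close> as the only other
      candidate.\<close>
    have "\<exists>w. \<forall>v\<in>insert x C. graph_degree F v \<le> 1 \<longrightarrow> v = x \<or> v = w"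
    proof (cases "graph_degree F z \<le> 1")
      case True
      then have "C = {z}" using dz C(4) by simp
      then show ?thesis by auto
    next
      case False
      have "v = x \<or> v = w" if "v \<in> insert x C" "graph_degree F v \<le> 1" for v
        using that C(3) mono[of v] False by auto
      then show ?thesis by blast
    qed
    then obtain w' where "\<forall>v\<in>insert x C. graph_degree F v \<le> 1 \<longrightarrow> v = x \<or> v = w'" by (elim exE)
    then show ?thesis using closed False by (intro exI[of _ "insert x C"] exI[of _ w']) simp
  qed
qed

section \<open>Kempe swaps\<close>

lemma proper_edge_coloring_insert:
  assumes "proper_edge_coloring E k c" "a < k" "e \<notin> E" "\<forall>v\<in>e. a \<in> missing E c v"
  shows "proper_edge_coloring (insert e E) k (c(e := a))"
  using assms unfolding proper_edge_coloring_def missing_def by (auto; blast)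

lemma proper_edge_coloring_subset:
  "proper_edge_coloring E k c \<Longrightarrow> F \<subseteq> E \<Longrightarrow> proper_edge_coloring F k c"
  unfolding proper_edge_coloring_def by (meson subsetD)

text \<open>All edges at one vertex are recoloured by the same permutation: the transposition of
  \<open>a\<close> and \<open>b\<close> if the vertex is in \<open>C\<close>, the identity
  otherwise. An edge that leaves \<open>C\<close> fits both descriptions, because by closedness its
  colour is neither \<open>a\<close> nor \<open>b\<close>. So edges that meet keep distinct
  colours.\<close>

lemma kempe_swap:
  assumes c: "proper_edge_coloring E k c" and ab: "a < k" "b < k" and C: "kempe_closed E c a b C"
  defines "c' \<equiv> \<lambda>e. if e \<subseteq> C then Transposition.transpose a b (c e) else c e"
  shows "proper_edge_coloring E k c'"
    and "v \<in> C \<Longrightarrow> a \<in> missing E c v \<Longrightarrow> b \<in> missing E c' v"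
    and "v \<notin> C \<Longrightarrow> missing E c' v = missing E c v"
proof -
  have inC: "c' e = Transposition.transpose a b (c e)" if "e \<in> E" "v \<in> e" "v \<in> C" for e v
    using C that unfolding kempe_closed_def c'_def by (auto simp: Transposition.transpose_def)
  have outC: "c' e = c e" if "v \<in> e" "v \<notin> C" for e v
    using that by (auto simp: c'_def)
  show "v \<in> C \<Longrightarrow> a \<in> missing E c v \<Longrightarrow> b \<in> missing E c' v"
    using inC unfolding missing_def by (auto simp: Transposition.transpose_def split: if_splits)
  show "v \<notin> C \<Longrightarrow> missing E c' v = missing E c v"
    using outC unfolding missing_def by auto
  have "c' e < k" if "e \<in> E" for e
    using c that ab unfolding c'_def proper_edge_coloring_def by (auto simp: Transposition.transpose_def)
  moreover have "c' e \<noteq> c' f" if ef: "e \<in> E" "f \<in> E" "e \<noteq> f" "e \<inter> f \<noteq> {}" for e f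
  proof -
    obtain v where v: "v \<in> e" "v \<in> f" using ef by blast
    have "c e \<noteq> c f" using c ef unfolding proper_edge_coloring_def by blast
    then show ?thesis using inC outC v ef by (metis Transposition.transpose_involutory)
  qed
  ultimately show "proper_edge_coloring E k c'"
    unfolding proper_edge_coloring_def by blast
qed

text \<open>The swap on \<open>C\<close> makes \<open>b\<close> missing at \<open>x\<close> and
  changes nothing at \<open>y\<close>, where \<open>b\<close> is missing already; the new edge gets
  colour \<open>b\<close>.\<close>

lemma proper_edge_coloring_insert_kempe:
  assumes c: "proper_edge_coloring E k c" and ab: "a < k" "b < k" and C: "kempe_closed E c a b C"
    and "x \<in> C" "y \<notin> C" "a \<in> missing E c x" "b \<in> missing E c y" "{x, y} \<notin> E"
  shows "\<exists>c'. proper_edge_coloring (insert {x, y} E) k c'"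
proof -
  let ?c = "\<lambda>e. if e \<subseteq> C then Transposition.transpose a b (c e) else c e"
  have "b \<in> missing E ?c x" using assms by (intro kempe_swap(2))
  moreover have "b \<in> missing E ?c y" using kempe_swap(3)[OF c ab C] assms by blast
  ultimately show ?thesis
    using proper_edge_coloring_insert[OF kempe_swap(1)[OF c ab C] ab(2)] assms by blast
qed

section \<open>Missing colours and the ends of Kempe chains\<close>

text \<open>Each colour of the palette is missing at \<open>v\<close> or used by one of its edges,
  and the edges use at most as many colours as there are edges.\<close>

lemma card_missing:
  assumes "finite E"
  shows "k \<le> graph_degree E v + card (missing E c v \<inter> {..<k})"
proof -
  have "{..<k} \<subseteq> c ` {e \<in> E. v \<in> e} \<union> (missing E c v \<inter> {..<k})"
    unfolding missing_def by auto
  then have "k \<le> card (c ` {e \<in> E. v \<in> e} \<union> (missing E c v \<inter> {..<k}))"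
    using assms card_mono[of _ "{..<k}"] by fastforce
  also have "\<dots> \<le> card (c ` {e \<in> E. v \<in> e}) + card (missing E c v \<inter> {..<k})"
    by (rule card_Un_le)
  also have "card (c ` {e \<in> E. v \<in> e}) \<le> graph_degree E v"
    unfolding graph_degree_def using assms by (intro card_image_le) simp
  finally show ?thesis by simp
qed

text \<open>Edges at \<open>v\<close> have distinct colours, none of them missing at
  \<open>v\<close>. Hence the subgraph in two colours has maximum degree two, and a vertex that
  misses one of the two colours has degree at most one in it.\<close>

lemma two_colors_degree:
  assumes c: "proper_edge_coloring E k c"
  shows "graph_degree {e \<in> E. c e \<in> {a, b}} v \<le> card ({a, b} - missing E c v)"
proof -
  have "inj_on c {e \<in> {e \<in> E. c e \<in> {a, b}}. v \<in> e}"
    using c unfolding proper_edge_coloring_def inj_on_def by blast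
  moreover have "c ` {e \<in> {e \<in> E. c e \<in> {a, b}}. v \<in> e} \<subseteq> {a, b} - missing E c v"
    unfolding missing_def by auto
  ultimately show ?thesis unfolding graph_degree_def by (intro card_inj_on_le) auto
qed

text \<open>Each of \<open>x\<close>, \<open>y\<close>, \<open>z\<close> misses \<open>a\<close> or
  \<open>b\<close> and so has degree at most one in the two-coloured subgraph. The closed set grown
  from \<open>x\<close> contains at most one such vertex besides \<open>x\<close>, hence not both
  \<open>y\<close> and \<open>z\<close>.\<close>

lemma kempe_closed_separating:
  assumes fin: "finite E" and two: "\<forall>e\<in>E. card e = 2" and c: "proper_edge_coloring E k c"
    and x: "a \<in> missing E c x" and y: "b \<in> missing E c y" and z: "b \<in> missing E c z"
    and ne: "x \<noteq> y" "x \<noteq> z" "y \<noteq> z"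
  obtains C where "kempe_closed E c a b C" "x \<in> C" "y \<notin> C \<or> z \<notin> C"
proof -
  define F where "F = {e \<in> E. c e \<in> {a, b}}"
  have deg: "graph_degree F v \<le> card ({a, b} - missing E c v)" for v
    unfolding F_def by (rule two_colors_degree[OF c])
  have "card ({a, b} - missing E c v) \<le> card {a, b}" for v by (intro card_mono) auto
  also have "card {a, b} \<le> 2" by (simp add: card_insert_if)
  finally have "\<forall>v. graph_degree F v \<le> 2" using deg le_trans by blast
  moreover have low: "graph_degree F v \<le> 1" if "a \<in> missing E c v \<or> b \<in> missing E c v" for v
  proof -
    have "{a, b} - missing E c v \<subseteq> {a} \<or> {a, b} - missing E c v \<subseteq> {b}" using that by auto
    then have "card ({a, b} - missing E c v) \<le> 1"
      by (metis card_mono finite.emptyI finite.insertI card.empty card_insert_disjoint empty_iff One_nat_def)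
    then show ?thesis using deg le_trans by blast
  qed
  ultimately obtain C w where C: "x \<in> C" "\<forall>e\<in>F. e \<inter> C \<noteq> {} \<longrightarrow> e \<subseteq> C"
    "\<forall>v\<in>C. graph_degree F v \<le> 1 \<longrightarrow> v = x \<or> v = w"
    using closed_set_with_two_ends[of F x] fin two x unfolding F_def by auto
  have "kempe_closed E c a b C" using C(2) unfolding kempe_closed_def F_def by auto
  moreover have "y \<notin> C \<or> z \<notin> C" using C(3) low y z ne by metis
  ultimately show ?thesis using that C(1) by blast
qed

section \<open>Extending a four-colouring by one edge\<close>

text \<open>A colour missing at both ends serves directly. Otherwise some edge \<open>{x, z}\<close>
  blocks a colour \<open>b\<close> that is free at \<open>y\<close>. Either it can be recoloured
  with a colour \<open>d\<close> missing at \<open>z\<close>, or \<open>d\<close> is missing at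
  \<open>y\<close> too, and a Kempe swap from \<open>x\<close> spares \<open>y\<close> or
  \<open>z\<close>; the new edge is then inserted at \<open>y\<close>, or the hole is first moved to
  \<open>z\<close>.\<close>

lemma proper_edge_coloring_extend:
  assumes fin: "finite E" and two: "\<forall>e\<in>E. card e = 2" and c: "proper_edge_coloring E 4 c"
    and xy: "x \<noteq> y" "{x, y} \<notin> E" and deg: "\<forall>v. graph_degree (insert {x, y} E) v \<le> 3"
  shows "\<exists>c'. proper_edge_coloring (insert {x, y} E) 4 c'"
proof (cases "missing E c x \<inter> missing E c y \<inter> {..<4} = {}")
  case False
  then show ?thesis using proper_edge_coloring_insert[OF c _ xy(2)] by blast
next
  case disj: True
  have insert_remove: "insert {x, y} E - {{x, y}} = E" using xy by auto
  have "graph_degree E x \<le> 2" "graph_degree E y \<le> 2"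
    using graph_degree_remove[of "insert {x, y} E" "{x, y}"] fin deg insert_remove
    by (metis (no_types, lifting) Suc_le_mono finite_insert insertI1 insert_commute numeral_2_eq_2 numeral_3_eq_3)+
  then have cards: "2 \<le> card (missing E c x \<inter> {..<4})" "2 \<le> card (missing E c y \<inter> {..<4})"
    using card_missing[OF fin, of 4 x c] card_missing[OF fin, of 4 y c] by linarith+
  \<comment> \<open>Two disjoint sets of at least two colours exhaust a palette of four, so a colour
    that is not missing at \<open>x\<close> is missing at \<open>y\<close>.\<close>
  have "card ((missing E c x \<inter> {..<4}) \<union> (missing E c y \<inter> {..<4}))
      = card (missing E c x \<inter> {..<4}) + card (missing E c y \<inter> {..<4})"
    using disj by (intro card_Un_disjoint) auto
  then have "card ((missing E c x \<inter> {..<4}) \<union> (missing E c y \<inter> {..<4})) \<ge> card {..<4::nat}"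
    using cards by simp
  then have union: "(missing E c x \<inter> {..<4}) \<union> (missing E c y \<inter> {..<4}) = {..<4}"
    by (intro card_seteq) auto
  obtain a where a: "a \<in> missing E c x" "a < 4"
    using cards(1) by (metis Int_iff all_not_in_conv card.empty lessThan_iff not_numeral_le_zero)
  obtain b where b: "b \<in> missing E c y" "b < 4"
    using cards(2) by (metis Int_iff all_not_in_conv card.empty lessThan_iff not_numeral_le_zero)
  have "b \<notin> missing E c x" using b disj by auto
  then obtain f where f: "f \<in> E" "x \<in> f" "c f = b" unfolding missing_def by auto
  obtain z where z: "f = {x, z}" "z \<noteq> x"
    using two f by (metis card_2_iff doubleton_eq_iff insertE singletonD)
  have zy: "z \<noteq> y" using f z xy by auto
  define E' where "E' = E - {f}"
  have E: "E = insert f E'" "f \<notin> E'" using f by (auto simp: E'_def)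
  have c': "proper_edge_coloring E' 4 c" using c by (rule proper_edge_coloring_subset) (auto simp: E'_def)
  have sub: "missing E c v \<subseteq> missing E' c v" for v unfolding missing_def E'_def by auto
  have bx: "b \<in> missing E' c x"
    using c f unfolding missing_def E'_def proper_edge_coloring_def by blast
  \<comment> \<open>Three edges cannot use all four colours, so some colour \<open>d\<close> is
    missing at \<open>z\<close>.\<close>
  have "graph_degree E z \<le> 3" using deg graph_degree_mono[of "insert {x, y} E" E z] fin
    by (meson finite_insert le_trans subset_insertI)
  then have "missing E c z \<inter> {..<4} \<noteq> {}"
    using card_missing[OF fin, of 4 z c] by force
  then obtain d where d: "d \<in> missing E c z" "d < 4" by auto
  have db: "d \<noteq> b" using d f z unfolding missing_def by auto
  show ?thesis
  proof (cases "d \<in> missing E c x")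
    case True
    \<comment> \<open>As \<open>d\<close> is missing at both ends of \<open>f\<close>, giving it to
      \<open>f\<close> frees \<open>b\<close> at \<open>x\<close>, and \<open>b\<close> is free at
      \<open>y\<close> anyway.\<close>
    have c2: "proper_edge_coloring E 4 (c(f := d))"
      unfolding E(1) using d True sub z by (intro proper_edge_coloring_insert[OF c' _ E(2)]) auto
    have "b \<in> missing E (c(f := d)) x" "b \<in> missing E (c(f := d)) y"
      using bx b db unfolding missing_def E'_def by auto
    then show ?thesis using proper_edge_coloring_insert[OF c2 b(2) xy(2)] by auto
  next
    case False
    then have dy: "d \<in> missing E c y" using union d(2) by auto
    \<comment> \<open>Now \<open>a\<close> is missing at \<open>x\<close> and \<open>d\<close> at
      both \<open>y\<close> and \<open>z\<close>: three potential ends for the chain from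
      \<open>x\<close>, which has room for two.\<close>
    obtain C where C: "kempe_closed E c a d C" "x \<in> C" "y \<notin> C \<or> z \<notin> C"
      using kempe_closed_separating[OF fin two c a(1) dy d(1)] xy zy z by metis
    show ?thesis
    proof (cases "y \<in> C")
      case False
      then show ?thesis
        using proper_edge_coloring_insert_kempe[OF c a(2) d(2) C(1,2) _ a(1) dy xy(2)] by simp
    next
      case True
      \<comment> \<open>Shift the fan: \<open>{x, y}\<close> takes over the colour of \<open>{x, z}\<close>, which is recoloured
        instead. The \<open>a\<close>/\<open>d\<close>-chains are the same as before.\<close>
      define E2 where "E2 = insert {x, y} E'"
      define c2 where "c2 = c({x, y} := b)"
      have "{x, y} \<notin> E'" using xy E by auto
      then have 1: "proper_edge_coloring E2 4 c2"
        unfolding E2_def c2_def using bx b sub by (intro proper_edge_coloring_insert[OF c']) auto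
      have ab: "a \<noteq> b" using a \<open>b \<notin> missing E c x\<close> by auto
      have 2: "kempe_closed E2 c2 a d C"
        using C(1) ab db unfolding kempe_closed_def E2_def c2_def E'_def by auto
      have 3: "a \<in> missing E2 c2 x" using a ab unfolding missing_def E2_def c2_def E'_def by auto
      have 4: "d \<in> missing E2 c2 z" using d db unfolding missing_def E2_def c2_def E'_def by auto
      have 5: "{x, z} \<notin> E2" using zy z E unfolding E2_def by (auto simp: doubleton_eq_iff)
      have "insert {x, z} E2 = insert {x, y} E" using z E unfolding E2_def by auto
      then show ?thesis
        using proper_edge_coloring_insert_kempe[OF 1 a(2) d(2) 2 C(2) _ 3 4 5] C(3) True by simp
    qed
  qed
qed

theorem four_edge_coloring_max_degree_3:
  assumes "finite E" "\<forall>e\<in>E. card e = 2" "\<forall>v. graph_degree E v \<le> 3"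
  shows "\<exists>c. proper_edge_coloring E 4 c"
  using assms
proof (induction E rule: finite_induct)
  case empty
  show ?case by (simp add: proper_edge_coloring_def)
next
  case (insert e E)
  obtain x y where e: "e = {x, y}" "x \<noteq> y" using insert.prems(1) by (metis card_2_iff insertI1)
  have "\<forall>v. graph_degree E v \<le> 3"
    using insert.prems(2) insert.hyps(1) graph_degree_mono[of "insert e E" E]
    by (meson finite_insert le_trans subset_insertI)
  then obtain c where "proper_edge_coloring E 4 c" using insert by auto
  then show ?case
    using proper_edge_coloring_extend[of E c x y] insert e by auto
qed

section \<open>Drawing\<close>

text \<open>The number \<open>t\<close> is the abscissa of the track, the vertical middle segment
  that carries both bends. In \<open>vchain\<close> the axes are interchanged and \<open>t\<close>
  is an ordinate.\<close>

definition hchain :: "real \<Rightarrow> point \<Rightarrow> point \<Rightarrow> chain" where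
  "hchain t p q = [p, (t, snd p), (t, snd q), q]"

definition vchain :: "real \<Rightarrow> point \<Rightarrow> point \<Rightarrow> chain" where
  "vchain t p q = [p, (fst p, t), (fst q, t), q]"

lemma closed_segment_horizontal:
  "closed_segment (a, y) (b, y :: real) = closed_segment a b \<times> {y}" for a b :: real
proof -
  have "(1 - u) * y + u * y = y" for u by (simp add: algebra_simps)
  then show ?thesis by (auto simp: closed_segment_def)
qed

lemma closed_segment_vertical:
  "closed_segment (x :: real, a) (x, b) = {x} \<times> closed_segment a b" for a b :: real
proof -
  have "(1 - u) * x + u * x = x" for u by (simp add: algebra_simps)
  then show ?thesis by (auto simp: closed_segment_def)
qed

lemma curve_three_segments:
  "curve [a, b, c, d] = closed_segment a b \<union> closed_segment b c \<union> closed_segment c d"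
  by (auto simp: curve_def num_segments_def segment_def lessThan_Suc)

lemma polygonal_chain_three_segments:
  "polygonal_chain [a, b, c, d] \<longleftrightarrow> a \<noteq> b \<and> b \<noteq> c \<and> c \<noteq> d \<and>
     closed_segment a b \<inter> closed_segment b c = {b} \<and>
     closed_segment b c \<inter> closed_segment c d = {c} \<and>
     closed_segment a b \<inter> closed_segment c d = {}"
proof -
  have pairs: "(\<forall>i j. i < j \<and> j < 3 \<longrightarrow> P i j) \<longleftrightarrow> P 0 1 \<and> P 1 2 \<and> P 0 2"
    for P :: "nat \<Rightarrow> nat \<Rightarrow> bool"
  proof -
    have "i < j \<and> j < 3 \<longleftrightarrow> i = 0 \<and> j = 1 \<or> i = 1 \<and> j = 2 \<or> i = 0 \<and> j = 2" for i j :: nat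
      by auto
    then show ?thesis by auto
  qed
  have three: "num_segments [a, b, c, d] = 3" by (simp add: num_segments_def)
  have "polygonal_chain [a, b, c, d] \<longleftrightarrow>
      (\<forall>i<3. [a, b, c, d] ! i \<noteq> [a, b, c, d] ! Suc i) \<and>
      closed_segment a b \<inter> closed_segment b c = {b} \<and>
      closed_segment b c \<inter> closed_segment c d = {c} \<and>
      closed_segment a b \<inter> closed_segment c d = {}"
    unfolding polygonal_chain_def three pairs by (simp add: segment_def numeral_2_eq_2)
  then show ?thesis by (simp add: numeral_3_eq_3 All_less_Suc conj_ac)
qed

definition axis_parallel :: "chain \<Rightarrow> bool" where
  "axis_parallel c \<longleftrightarrow>
     (\<forall>i<num_segments c. horizontal (c ! i) (c ! Suc i) \<or> vertical (c ! i) (c ! Suc i))"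

text \<open>Pairs of corners replace indices, so that simplification can expand the nine pairs of
  segments.\<close>

lemma right_angle_at_three_segments:
  "right_angle_at [a, b, c, d] [a', b', c', d'] z \<longleftrightarrow>
     (\<exists>s\<in>{(a, b), (b, c), (c, d)}. \<exists>r\<in>{(a', b'), (b', c'), (c', d')}.
        z \<in> open_segment (fst s) (snd s) \<and> z \<in> open_segment (fst r) (snd r) \<and>
        orthogonal (snd s - fst s) (snd r - fst r))"
proof -
  have ex: "(\<exists>i<num_segments [a, b, c, d]. P ([a, b, c, d] ! i) ([a, b, c, d] ! Suc i)) \<longleftrightarrow>
      (\<exists>s\<in>{(a, b), (b, c), (c, d)}. P (fst s) (snd s))"
    for a b c d and P :: "point \<Rightarrow> point \<Rightarrow> bool"
    by (simp add: num_segments_def Ex_less_Suc disj_ac)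
  let ?R = "\<lambda>p q p' q'. z \<in> open_segment p q \<and> z \<in> open_segment p' q' \<and> orthogonal (q - p) (q' - p')"
  let ?c = "[a, b, c, d]" and ?d = "[a', b', c', d']"
  have "right_angle_at ?c ?d z \<longleftrightarrow> (\<exists>i<num_segments ?c. \<exists>j<num_segments ?d.
      ?R (?c ! i) (?c ! Suc i) (?d ! j) (?d ! Suc j))"
    unfolding right_angle_at_def ..
  also have "\<dots> \<longleftrightarrow> (\<exists>s\<in>{(a, b), (b, c), (c, d)}. \<exists>j<num_segments ?d.
      ?R (fst s) (snd s) (?d ! j) (?d ! Suc j))"
    by (rule ex)
  also have "\<dots> \<longleftrightarrow> (\<exists>s\<in>{(a, b), (b, c), (c, d)}. \<exists>r\<in>{(a', b'), (b', c'), (c', d')}.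
      ?R (fst s) (snd s) (fst r) (snd r))"
    by (intro bex_cong refl ex)
  finally show ?thesis .
qed

lemma mem_curve_hchain:
  "z \<in> curve (hchain t p q) \<longleftrightarrow>
     snd z = snd p \<and> fst z \<in> closed_segment (fst p) t \<or>
     fst z = t \<and> snd z \<in> closed_segment (snd p) (snd q) \<or>
     snd z = snd q \<and> fst z \<in> closed_segment t (fst q)"
  by (cases p; cases q; cases z)
    (auto simp: hchain_def curve_three_segments closed_segment_horizontal closed_segment_vertical)

lemma mem_curve_vchain:
  "z \<in> curve (vchain t p q) \<longleftrightarrow>
     fst z = fst p \<and> snd z \<in> closed_segment (snd p) t \<or>
     snd z = t \<and> fst z \<in> closed_segment (fst p) (fst q) \<or>
     fst z = fst q \<and> snd z \<in> closed_segment t (snd q)"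
  by (cases p; cases q; cases z)
    (auto simp: vchain_def curve_three_segments closed_segment_horizontal closed_segment_vertical)

lemma polygonal_chain_hchain:
  assumes "snd p \<noteq> snd q" "t \<noteq> fst p" "t \<noteq> fst q"
  shows "polygonal_chain (hchain t p q)"
  using assms by (cases p; cases q)
    (auto simp: hchain_def polygonal_chain_three_segments
      closed_segment_horizontal closed_segment_vertical)

lemma polygonal_chain_vchain:
  assumes "fst p \<noteq> fst q" "t \<noteq> snd p" "t \<noteq> snd q"
  shows "polygonal_chain (vchain t p q)"
  using assms by (cases p; cases q)
    (auto simp: vchain_def polygonal_chain_three_segments
      closed_segment_horizontal closed_segment_vertical)

lemma axis_parallel_hchain: "axis_parallel (hchain t p q)"
  by (simp add: axis_parallel_def num_segments_def hchain_def horizontal_def vertical_def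
      All_less_Suc)

lemma axis_parallel_vchain: "axis_parallel (vchain t p q)"
  by (simp add: axis_parallel_def num_segments_def vchain_def horizontal_def vertical_def
      All_less_Suc)

section \<open>Right-angle crossings exclude overlaps\<close>

lemma right_angle_at_sym: "right_angle_at c d p \<Longrightarrow> right_angle_at d c p"
  unfolding right_angle_at_def by (metis orthogonal_commute)

lemma horizontal_segment_snd: "z \<in> closed_segment p q \<Longrightarrow> horizontal p q \<Longrightarrow> snd z = snd p"
  by (cases p; cases q) (auto simp: horizontal_def closed_segment_horizontal)

lemma vertical_segment_fst: "z \<in> closed_segment p q \<Longrightarrow> vertical p q \<Longrightarrow> fst z = fst p"
  by (cases p; cases q) (auto simp: vertical_def closed_segment_vertical)

text \<open>Of two perpendicular axis-parallel segments one is vertical and fixes the abscissa of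
  the crossing, the other is horizontal and fixes its ordinate. Crossings thus lie in a finite
  set.\<close>

lemma right_angle_at_coordinates:
  assumes "axis_parallel c" "axis_parallel d" "right_angle_at c d z"
  shows "z \<in> fst ` (set c \<union> set d) \<times> snd ` (set c \<union> set d)"
proof -
  obtain i j where ij: "i < num_segments c" "j < num_segments d"
    "z \<in> open_segment (c ! i) (c ! Suc i)" "z \<in> open_segment (d ! j) (d ! Suc j)"
    "orthogonal (c ! Suc i - c ! i) (d ! Suc j - d ! j)"
    using assms(3) unfolding right_angle_at_def by blast
  have mem: "c ! i \<in> set c" "d ! j \<in> set d"
    using ij(1,2) unfolding num_segments_def by auto
  have ne: "c ! i \<noteq> c ! Suc i" "d ! j \<noteq> d ! Suc j" using ij(3,4) by auto
  have z: "z \<in> closed_segment (c ! i) (c ! Suc i)" "z \<in> closed_segment (d ! j) (d ! Suc j)"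
    using ij(3,4) by (auto simp: open_segment_def)
  \<comment> \<open>Nonzero vectors along the same axis are not orthogonal.\<close>
  have "\<not> (horizontal (c ! i) (c ! Suc i) \<and> horizontal (d ! j) (d ! Suc j))"
    "\<not> (vertical (c ! i) (c ! Suc i) \<and> vertical (d ! j) (d ! Suc j))"
    using ij(5) ne
    by (auto simp: horizontal_def vertical_def orthogonal_def inner_prod_def prod_eq_iff)
  then consider "horizontal (c ! i) (c ! Suc i)" "vertical (d ! j) (d ! Suc j)"
    | "vertical (c ! i) (c ! Suc i)" "horizontal (d ! j) (d ! Suc j)"
    using assms(1,2) ij(1,2) unfolding axis_parallel_def by blast
  then have "fst z \<in> fst ` (set c \<union> set d) \<and> snd z \<in> snd ` (set c \<union> set d)"
  proof cases
    case 1
    then show ?thesis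
      using horizontal_segment_snd[OF z(1)] vertical_segment_fst[OF z(2)] mem by simp
  next
    case 2
    then show ?thesis
      using horizontal_segment_snd[OF z(2)] vertical_segment_fst[OF z(1)] mem by simp
  qed
  then show ?thesis by (simp add: mem_Times_iff)
qed

text \<open>The chains have only finitely many common points, whereas a segment between distinct
  points is infinite. The set \<open>A\<close> will hold the common end vertices.\<close>

lemma right_angle_crossings_imp_not_overlap:
  assumes "axis_parallel c" "axis_parallel d" "finite A"
    and "\<And>z. z \<in> curve c \<inter> curve d \<Longrightarrow> z \<in> A \<or> right_angle_at c d z"
  shows "\<not> overlap c d"
proof
  assume "overlap c d"
  then obtain a b where ab: "a \<noteq> b" "closed_segment a b \<subseteq> curve c \<inter> curve d"
    unfolding overlap_def by blast
  have "curve c \<inter> curve d \<subseteq> A \<union> fst ` (set c \<union> set d) \<times> snd ` (set c \<union> set d)"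
    using assms(4) right_angle_at_coordinates[OF assms(1,2)] by blast
  then have "finite (closed_segment a b)"
    using ab(2) assms(3) by (meson List.finite_set finite_SigmaI finite_UnI finite_imageI finite_subset)
  then show False using ab(1) by simp
qed

section \<open>Common points of two chains\<close>

text \<open>For edges of one colour, which share no vertex. The tracks are distinct and so are the
  rows, so \<open>z\<close> lies on the track of one chain and on a row of the other; the remaining
  inequalities keep it away from all corners.\<close>

lemma hchain_hchain_same_side:
  assumes "z \<in> curve (hchain t p q)" "z \<in> curve (hchain t' p' q')"
    and "t \<noteq> t'" "t \<notin> {fst p', fst q'}" "t' \<notin> {fst p, fst q}"
    and "snd p \<notin> {snd p', snd q'}" "snd q \<notin> {snd p', snd q'}"
  shows "right_angle_at (hchain t p q) (hchain t' p' q') z"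
  using assms unfolding mem_curve_hchain
  by (cases p; cases q; cases p'; cases q'; cases z)
    (auto simp: hchain_def right_angle_at_three_segments open_segment_def
      closed_segment_horizontal closed_segment_vertical orthogonal_def inner_prod_def)

lemma vchain_vchain_same_side:
  assumes "z \<in> curve (vchain t p q)" "z \<in> curve (vchain t' p' q')"
    and "t \<noteq> t'" "t \<notin> {snd p', snd q'}" "t' \<notin> {snd p, snd q}"
    and "fst p \<notin> {fst p', fst q'}" "fst q \<notin> {fst p', fst q'}"
  shows "right_angle_at (vchain t p q) (vchain t' p' q') z"
  using assms unfolding mem_curve_vchain
  by (cases p; cases q; cases p'; cases q'; cases z)
    (auto simp: vchain_def right_angle_at_three_segments open_segment_def
      closed_segment_horizontal closed_segment_vertical orthogonal_def inner_prod_def)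

text \<open>On a row, a chain with a left track stays to the left of its vertex, and one with a
  right track to the right. Since each row holds one point of \<open>S\<close>, the chains can meet
  only in a common end.\<close>

lemma hchain_hchain_opposite:
  assumes z: "z \<in> curve (hchain t p q)" "z \<in> curve (hchain t' p' q')"
    and S: "{p, q, p', q'} \<subseteq> S" "\<forall>s\<in>S. t < fst s \<and> fst s < t'" "inj_on snd S"
  shows "z \<in> {p, q} \<inter> {p', q'}"
proof -
  have t: "t < fst s" "fst s < t'" if "s \<in> {p, q, p', q'}" for s
    using S(1,2) that by blast+
  have "fst z = t \<or> (\<exists>r\<in>{p, q}. snd z = snd r \<and> fst z \<in> closed_segment t (fst r))"
    using z(1) unfolding mem_curve_hchain by (auto simp: closed_segment_commute)
  then have left: "fst z = t \<or> (\<exists>r\<in>{p, q}. snd z = snd r \<and> fst z \<le> fst r)"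
    using t[of p] t[of q] by (auto simp: closed_segment_eq_real_ivl)
  have "fst z = t' \<or> (\<exists>r\<in>{p', q'}. snd z = snd r \<and> fst z \<in> closed_segment t' (fst r))"
    using z(2) unfolding mem_curve_hchain by (auto simp: closed_segment_commute)
  then have right: "fst z = t' \<or> (\<exists>r\<in>{p', q'}. snd z = snd r \<and> fst r \<le> fst z)"
    using t[of p'] t[of q'] by (auto simp: closed_segment_eq_real_ivl)
  \<comment> \<open>No point of the left chain reaches the right track, so \<open>z\<close> is on a
    row of the right chain; this in turn places it off the left track.\<close>
  have "fst z < t'" using left t[of p] t[of q] by auto
  then obtain r' where r': "r' \<in> {p', q'}" "snd z = snd r'" "fst r' \<le> fst z" using right by (metis less_irrefl)
  then have "t < fst z" using t[of r'] by auto
  then obtain r where r: "r \<in> {p, q}" "snd z = snd r" "fst z \<le> fst r" using left by (metis less_irrefl)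
  have "r \<in> S" "r' \<in> S" using r(1) r'(1) S(1) by auto
  then have "r = r'" using S(3) r(2) r'(2) by (auto dest: inj_onD)
  then have "z = r" using r r' by (auto simp: prod_eq_iff)
  then show ?thesis using r(1) r'(1) \<open>r = r'\<close> by simp
qed

lemma vchain_vchain_opposite:
  assumes z: "z \<in> curve (vchain t p q)" "z \<in> curve (vchain t' p' q')"
    and S: "{p, q, p', q'} \<subseteq> S" "\<forall>s\<in>S. t < snd s \<and> snd s < t'" "inj_on fst S"
  shows "z \<in> {p, q} \<inter> {p', q'}"
proof -
  have t: "t < snd s" "snd s < t'" if "s \<in> {p, q, p', q'}" for s
    using S(1,2) that by blast+
  have "snd z = t \<or> (\<exists>r\<in>{p, q}. fst z = fst r \<and> snd z \<in> closed_segment t (snd r))"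
    using z(1) unfolding mem_curve_vchain by (auto simp: closed_segment_commute)
  then have left: "snd z = t \<or> (\<exists>r\<in>{p, q}. fst z = fst r \<and> snd z \<le> snd r)"
    using t[of p] t[of q] by (auto simp: closed_segment_eq_real_ivl)
  have "snd z = t' \<or> (\<exists>r\<in>{p', q'}. fst z = fst r \<and> snd z \<in> closed_segment t' (snd r))"
    using z(2) unfolding mem_curve_vchain by (auto simp: closed_segment_commute)
  then have right: "snd z = t' \<or> (\<exists>r\<in>{p', q'}. fst z = fst r \<and> snd r \<le> snd z)"
    using t[of p'] t[of q'] by (auto simp: closed_segment_eq_real_ivl)
  have "snd z < t'" using left t[of p] t[of q] by auto
  then obtain r' where r': "r' \<in> {p', q'}" "fst z = fst r'" "snd r' \<le> snd z" using right by (metis less_irrefl)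
  then have "t < snd z" using t[of r'] by auto
  then obtain r where r: "r \<in> {p, q}" "fst z = fst r" "snd z \<le> snd r" using left by (metis less_irrefl)
  have "r \<in> S" "r' \<in> S" using r(1) r'(1) S(1) by auto
  then have "r = r'" using S(3) r(2) r'(2) by (auto dest: inj_onD)
  then have "z = r" using r r' by (auto simp: prod_eq_iff)
  then show ?thesis using r(1) r'(1) \<open>r = r'\<close> by simp
qed

text \<open>The vertical track avoids all columns of \<open>S\<close>, and the horizontal one avoids
  all rows of \<open>S\<close> and passes beside the vertical track. So \<open>z\<close> is where
  the row of an end \<open>r\<close> meets the column of an end \<open>r'\<close>: a shared vertex
  if \<open>r = r'\<close>, and otherwise a point interior to both segments.\<close>

lemma hchain_vchain:
  assumes z: "z \<in> curve (hchain t p q)" "z \<in> curve (vchain t' p' q')"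
    and S: "{p, q, p', q'} \<subseteq> S" "inj_on fst S" "inj_on snd S"
    and t: "t \<notin> fst ` S" and t': "t' \<notin> closed_segment (snd p) (snd q)" "t' \<notin> snd ` S"
  shows "z \<in> {p, q} \<inter> {p', q'} \<or> right_angle_at (hchain t p q) (vchain t' p' q') z"
proof -
  have inj: "fst r = fst r' \<longleftrightarrow> r = r'" "snd r = snd r' \<longleftrightarrow> r = r'" if "r \<in> S" "r' \<in> S" for r r'
    using S(2,3) that by (auto dest: inj_onD)
  have "\<exists>r\<in>{p, q}. \<exists>r'\<in>{p', q'}. z = (fst r', snd r) \<and>
      fst z \<in> closed_segment t (fst r) \<and> snd z \<in> closed_segment t' (snd r')"
    using z S(1) t t' unfolding mem_curve_hchain mem_curve_vchain
    by (cases z) (auto simp: closed_segment_commute)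
  then obtain r r' where r: "r \<in> {p, q}" "r' \<in> {p', q'}" "z = (fst r', snd r)"
    "fst z \<in> closed_segment t (fst r)" "snd z \<in> closed_segment t' (snd r')"
    by blast
  show ?thesis
  proof (cases "r = r'")
    case True
    then show ?thesis using r by auto
  next
    case False
    have rS: "r \<in> S" "r' \<in> S" using r(1,2) S(1) by auto
    then have ne: "fst r \<noteq> fst r'" "snd r \<noteq> snd r'" using inj[OF rS] False by auto
    have tt: "t \<noteq> fst r'" "t' \<noteq> snd r" using t t' rS by auto
    have "z \<in> open_segment (t, snd r) r" "z \<in> open_segment (fst r', t') r'"
      using r(3-5) ne tt
      by (cases r; cases r'; auto simp: open_segment_def closed_segment_horizontal closed_segment_vertical)+
    moreover have "orthogonal (r - (t, snd r)) (r' - (fst r', t'))"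
      by (simp add: orthogonal_def inner_prod_def)
    ultimately show ?thesis using r(1,2)
      unfolding hchain_def vchain_def right_angle_at_three_segments
      by (auto simp: open_segment_commute orthogonal_def inner_prod_def)
  qed
qed

lemma hchain_avoids:
  assumes "inj_on snd S" "{p, q, s} \<subseteq> S" "s \<notin> {p, q}" "t \<notin> fst ` S"
  shows "s \<notin> curve (hchain t p q)"
proof -
  have "snd s \<noteq> snd p" "snd s \<noteq> snd q" using assms(1-3) by (auto dest: inj_onD)
  moreover have "fst s \<noteq> t" using assms(2,4) by auto
  ultimately show ?thesis by (simp add: mem_curve_hchain)
qed

lemma vchain_avoids:
  assumes "inj_on fst S" "{p, q, s} \<subseteq> S" "s \<notin> {p, q}" "t \<notin> snd ` S"
  shows "s \<notin> curve (vchain t p q)"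
proof -
  have "fst s \<noteq> fst p" "fst s \<noteq> fst q" using assms(1-3) by (auto dest: inj_onD)
  moreover have "snd s \<noteq> t" using assms(2,4) by auto
  ultimately show ?thesis by (simp add: mem_curve_vchain)
qed

section \<open>Assembling the drawing\<close>

theorem theorem4:
  fixes V :: "'a set" and E :: "'a set set" and n :: nat
    and S :: "(real \<times> real) set" and \<mu> :: "'a \<Rightarrow> real \<times> real"
  assumes "simple_graph V E"
    and "card V = n"
    and "\<forall>v\<in>V. graph_degree E v \<le> 3"
    and "grid_point_set n S"
    and "bij_betw \<mu> V S"
  shows "\<exists>D. restricted_RAC_embedding 2 V E S \<mu> D"
proof -
  have EV: "e \<subseteq> V" and two: "card e = 2" if "e \<in> E" for e
    using assms(1) that by (auto simp: simple_graph_def)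
  have "E \<subseteq> Pow V" using EV by auto
  then have finE: "finite E"
    using assms(1) by (meson simple_graph_def finite_Pow_iff finite_subset)
  \<comment> \<open>The colouring theorem bounds the degree at every element of the type; outside
    \<open>V\<close> it is zero.\<close>
  have "graph_degree E v \<le> 3" for v
  proof (cases "v \<in> V")
    case False
    then have "graph_degree E v = 0" using EV finE by (auto simp: graph_degree_eq_0_iff)
    then show ?thesis by simp
  qed (use assms(3) in simp)
  then obtain c where c: "proper_edge_coloring E 4 c"
    using four_edge_coloring_max_degree_3[OF finE] two by blast
  \<comment> \<open>The numbering of the edges will give different tracks to edges of the same
    colour.\<close>
  obtain i :: "'a set \<Rightarrow> nat" where i: "inj_on i E"
    using finE by (metis finite_imp_inj_to_nat_seg)
  have "\<forall>e\<in>E. \<exists>u w. e = {u, w} \<and> u \<noteq> w" using two by (meson card_2_iff)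
  then obtain P Q where PQ: "\<And>e. e \<in> E \<Longrightarrow> e = {P e, Q e} \<and> P e \<noteq> Q e" by metis
  define p where "p e = \<mu> (P e)" for e
  define q where "q e = \<mu> (Q e)" for e
  have inj: "inj_on \<mu> V" and img: "\<mu> ` V = S" using assms(5) by (auto simp: bij_betw_def)
  have ends: "\<mu> ` e = {p e, q e}" if "e \<in> E" for e
    using PQ[OF that] unfolding p_def q_def by (metis image_empty image_insert)
  have pqS: "p e \<in> S" "q e \<in> S" if "e \<in> E" for e
    using ends[OF that] EV[OF that] img by blast+
  have pq: "p e \<noteq> q e" if "e \<in> E" for e
    using PQ[OF that] EV[OF that] inj unfolding p_def q_def by (metis inj_onD insert_subset)
  have "S \<subseteq> real ` {1..n} \<times> real ` {1..n}" using assms(4) by (simp add: grid_point_set_def)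
  then have S: "1 \<le> fst s" "fst s \<le> n" "1 \<le> snd s" "snd s \<le> n" "fst s \<in> \<int>" "snd s \<in> \<int>"
    if "s \<in> S" for s using that by auto
  have inj_fst: "inj_on fst S" and inj_snd: "inj_on snd S"
    using assms(4) by (auto simp: grid_point_set_def inj_on_def)
  \<comment> \<open>The colours 0, 1, 2, 3 stand for the directions left, right, down, up.\<close>
  define T where "T e = (if even (c e) then - real (i e) else n + 1 + real (i e))" for e
  \<comment> \<open>Even colours, left and down, have tracks at coordinates at most 0; odd ones,
    right and up, at \<open>n + 1\<close> or beyond. No track meets the grid.\<close>
  have Tin: "T e < 1" if "even (c e)" for e using that by (simp add: T_def)
  have Tout: "n < T e" if "odd (c e)" for e using that by (simp add: T_def)
  have T: "T e < 1 \<or> n < T e" for e using Tin Tout by blast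
  have TS: "T e \<notin> fst ` S" "T e \<notin> snd ` S" for e
    using T[of e] S by fastforce+
  define D where "D e = (if c e < 2 then hchain (T e) (p e) (q e) else vchain (T e) (p e) (q e))" for e
  have par: "axis_parallel (D e)" for e
    by (simp add: D_def axis_parallel_hchain axis_parallel_vchain)
  have poly: "polygonal_chain (D e)" if e: "e \<in> E" for e
  proof -
    have "fst (p e) \<noteq> fst (q e)" "snd (p e) \<noteq> snd (q e)"
      using pq[OF e] pqS[OF e] inj_fst inj_snd by (auto dest: inj_onD)
    moreover have "T e \<noteq> fst (p e)" "T e \<noteq> fst (q e)" "T e \<noteq> snd (p e)" "T e \<noteq> snd (q e)"
      using TS[of e] pqS[OF e] by auto
    ultimately show ?thesis
      by (simp add: D_def polygonal_chain_hchain polygonal_chain_vchain)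
  qed
  \<comment> \<open>Ordering the two edges by colour leaves four cases; the reverse order follows
    from the symmetry of \<open>right_angle_at\<close>.\<close>
  have meet_le: "z \<in> {p e, q e} \<inter> {p f, q f} \<or> right_angle_at (D e) (D f) z"
    if ef: "e \<in> E" "f \<in> E" "e \<noteq> f" "c e \<le> c f" and z: "z \<in> curve (D e)" "z \<in> curve (D f)"
    for e f z
  proof -
    note mem = pqS[OF ef(1)] pqS[OF ef(2)]
    have sub: "{p e, q e, p f, q f} \<subseteq> S" using mem by simp
    have "c f < 4" using c ef(2) by (simp add: proper_edge_coloring_def)
    then consider (same) "c e = c f" | (opposite_h) "c e = 0" "c f = 1"
      | (opposite_v) "c e = 2" "c f = 3" | (hv) "c e < 2" "c f \<ge> 2"
      using ef(4) by linarith
    then show ?thesis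
    proof cases
      case same
      then have "e \<inter> f = {}" using c ef unfolding proper_edge_coloring_def by blast
      then have "\<mu> ` e \<inter> \<mu> ` f = {}"
        using inj_on_image_Int[OF inj] EV ef(1,2) by (metis image_empty)
      then have "{p e, q e} \<inter> {p f, q f} = {}" using ends ef(1,2) by simp
      then have "fst ` {p e, q e} \<inter> fst ` {p f, q f} = {}" "snd ` {p e, q e} \<inter> snd ` {p f, q f} = {}"
        using inj_on_image_Int[OF inj_fst, of "{p e, q e}" "{p f, q f}"]
          inj_on_image_Int[OF inj_snd, of "{p e, q e}" "{p f, q f}"] sub by auto
      moreover have "T e \<noteq> T f" using same i ef(1-3) by (auto simp: T_def dest: inj_onD)
      moreover have "T e \<notin> fst ` {p f, q f}" "T f \<notin> fst ` {p e, q e}"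
         "T e \<notin> snd ` {p f, q f}" "T f \<notin> snd ` {p e, q e}"
        using TS[of e] TS[of f] mem by auto
      ultimately have "right_angle_at (D e) (D f) z"
        using z same hchain_hchain_same_side[of z "T e" "p e" "q e" "T f" "p f" "q f"]
          vchain_vchain_same_side[of z "T e" "p e" "q e" "T f" "p f" "q f"]
        unfolding D_def by (auto split: if_splits)
      then show ?thesis ..
    next
      case opposite_h
      then have "T e < 1" "n < T f" using Tin Tout by simp_all
      then have "\<forall>s\<in>S. T e < fst s \<and> fst s < T f" using S by fastforce
      then have "z \<in> {p e, q e} \<inter> {p f, q f}"
        using hchain_hchain_opposite[OF _ _ sub _ inj_snd] z opposite_h by (simp add: D_def)
      then show ?thesis ..
    next
      case opposite_v
      then have "T e < 1" "n < T f" using Tin Tout by simp_all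
      then have "\<forall>s\<in>S. T e < snd s \<and> snd s < T f" using S by fastforce
      then have "z \<in> {p e, q e} \<inter> {p f, q f}"
        using vchain_vchain_opposite[OF _ _ sub _ inj_fst] z opposite_v by (simp add: D_def)
      then show ?thesis ..
    next
      case hv
      \<comment> \<open>The track of \<open>e\<close> spans only the rows between its ends, which
        lie within 1 and \<open>n\<close>, so the track of \<open>f\<close> passes above or below
        it.\<close>
      have "T f \<notin> closed_segment (snd (p e)) (snd (q e))"
        using T[of f] S[OF mem(1)] S[OF mem(2)] by (auto simp: closed_segment_eq_real_ivl)
      then show ?thesis
        using hchain_vchain[OF _ _ sub inj_fst inj_snd TS(1) _ TS(2)] z hv by (simp add: D_def)
    qed
  qed
  have meet: "z \<in> \<mu> ` (e \<inter> f) \<or> right_angle_at (D e) (D f) z"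
    if ef: "e \<in> E" "f \<in> E" "e \<noteq> f" and z: "z \<in> curve (D e) \<inter> curve (D f)" for e f z
  proof -
    \<comment> \<open>By injectivity of \<open>\<mu>\<close>, the common ends of the chains are the
      images of the common vertices, which \<open>crossing\<close> exempts.\<close>
    have "\<mu> ` (e \<inter> f) = {p e, q e} \<inter> {p f, q f}"
      using inj_on_image_Int[OF inj] EV ends ef(1,2) by metis
    then show ?thesis
      using meet_le[of e f z] meet_le[of f e z] ef z right_angle_at_sym by (metis Int_commute IntE nle_le)
  qed
  have no_overlap: "\<not> overlap (D e) (D f)" if "e \<in> E" "f \<in> E" "e \<noteq> f" for e f
  proof (rule right_angle_crossings_imp_not_overlap[OF par par])
    have "finite e" using two[OF that(1)] by (simp add: card_ge_0_finite)
    then show "finite (\<mu> ` (e \<inter> f))" by simp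
  qed (use meet that in blast)
  have avoids: "\<mu> v \<notin> curve (D e)" if "e \<in> E" "v \<in> V" "v \<notin> e" for e v
  proof -
    have v: "\<mu> v \<in> S" using img that by auto
    have "\<mu> v \<notin> \<mu> ` e" using inj that EV by (metis inj_on_image_mem_iff)
    then have v': "\<mu> v \<notin> {p e, q e}" using ends that by simp
    have "{p e, q e, \<mu> v} \<subseteq> S" using v pqS[OF that(1)] by simp
    then show ?thesis
      using hchain_avoids[OF inj_snd _ v' TS(1)] vchain_avoids[OF inj_fst _ v' TS(2)]
      by (simp add: D_def)
  qed
  have hd_last: "{hd (D e), last (D e)} = \<mu> ` e" if "e \<in> E" for e
    using ends[OF that] by (simp add: D_def hchain_def vchain_def)
  have embedding: "point_set_embedding V E S \<mu> D"
    unfolding point_set_embedding_def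
    by (intro conjI ballI impI assms(5) poly hd_last no_overlap avoids)
  have integral: "fst b \<in> \<int>" "snd b \<in> \<int>" if "e \<in> E" "b \<in> set (bends (D e))" for e b
  proof -
    have "T e \<in> \<int>" by (simp add: T_def)
    then show "fst b \<in> \<int>" "snd b \<in> \<int>"
      using that(2) S(5,6)[OF pqS(1)[OF that(1)]] S(5,6)[OF pqS(2)[OF that(1)]]
      by (auto simp: D_def hchain_def vchain_def bends_def split: if_splits)
  qed
  have few_bends: "length (bends (D e)) \<le> 2" for e
    by (simp add: D_def hchain_def vchain_def bends_def)
  have right_angles: "right_angle_at (D e) (D f) z"
    if "e \<in> E" "f \<in> E" "e \<noteq> f \<and> crossing \<mu> D e f z" for e f z
    using meet[of e f z] that by (simp add: crossing_def)
  have "restricted_RAC_embedding 2 V E S \<mu> D"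
    unfolding restricted_RAC_embedding_def
    by (intro conjI ballI allI impI embedding integral few_bends right_angles
        par[unfolded axis_parallel_def, rule_format]) auto
  then show ?thesis by (rule exI[of _ D])
qed

end
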